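(* (Completeness for $\mathcal{U}$) For any closed formula $A$ and closed context $\Gamma$ of MQC, in the universal IK-CPS model $\mathcal{U}$: (reify) if $\Gamma\Vdash A$, then there is a proof term $p$ in normal form with $\Gamma\vdash p:A$; (reflect) if $e$ is a neutral proof term with $\Gamma\vdash e:A$, then $\Gamma\Vdash A$.
   Context: MQC is minimal intuitionistic predicate logic: natural deduction with proof terms, judgements $\Gamma\vdash p:A$, rules: axiom $a$; $\wedge$: $(p,q)$, $\pi_1p$, $\pi_2p$; $\vee$: $\iota_1p$, $\iota_2p$, $\mathrm{case}\ p\ \mathrm{of}\ (a_1.q_1\|a_2.q_2)$ (from $\Gamma\vdash p:A_1\vee A_2$, $\Gamma,a_i:A_i\vdash q_i:C$ infer $C$); $\Rightarrow$: $\lambda a.p$, $p\,q$; $\forall$: $\lambda x.p$ ($x$ fresh), $p\,t$; $\exists$: $(t,p)$ from $A(t)$, and $\mathrm{dest}\ p\ \mathrm{as}\ (x,a)\ \mathrm{in}\ q$ (from $\Gamma\vdash p:\exists x.A(x)$ and $\Gamma,a:A(x)\vdash q:C$, $x$ fresh, infer $C$). Normal terms $r$ and neutral terms $e$ are defined by $r ::= e \mid \lambda a.r \mid \iota_1 r\mid \iota_2 r\mid (r_1,r_2)\mid \lambda x.r\mid (t,r)$, $e ::= a \mid e\,r \mid \mathrm{case}\ e\ \mathrm{of}\ (a_1.r_1\|a_2.r_2)\mid \pi_1 e\mid \pi_2 e\mid e\,t\mid \mathrm{dest}\ e\ \mathrm{as}\ (x,a)\ \mathrm{in}\ r$. A derivation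 is in normal form if its proof term is normal. An IK-CPS model consists of a preorder $(K,\le)$ of worlds, a binary relation $w\Vdash_\bot^{C}$ between worlds and formulas, a monotone strong forcing $w\Vdash_s X$ on atomic formulas, and increasing domains $D(w)$. Strong forcing is extended simultaneously with forcing: $w \Vdash A$ iff for every formula $C$ and every $w'\ge w$, if for all $w''\ge w'$ ($w''\Vdash_s A$ implies $w''\Vdash_\bot^{C}$), then $w'\Vdash_\bot^{C}$; $w\Vdash_s A\wedge B$ iff $w\Vdash A$ and $w\Vdash B$; $w\Vdash_s A\vee B$ iff $w\Vdash A$ or $w\Vdash B$; $w\Vdash_s A\Rightarrow B$ iff for all $w'\ge w$, $w'\Vdash A$ implies $w'\Vdash B$; $w\Vdash_s\forall x.A(x)$ iff for all $w'\ge w$, $t\in D(w')$, $w'\Vdash A(t)$; $w\Vdash_s\exists x.A(x)$ iff $w\Vdash A(t)$ for some $t\in D(w)$. The universal model $\mathcal{U}$: worlds are contexts $\Gamma$ of MQC ordered by inclusion; $\Gamma\Vdash_s X$ iff there is a normal derivation of $\Gamma\vdash X$ ($X$ atomic); $\Gamma\Vdash_\bot^{C}$ iff there is a normal derivation of $\Gamma\vdash C$; $D(\Gamma)$ is a constant set of individuals of MQC. *)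

theory Defs
  imports "HOL-Library.Finite_Map"
begin

section \<open>Formulas\<close>

text \<open>
  Individual variables are de Bruijn indices, so formulas are identified up to
  alpha-equivalence: \<open>Forall A\<close> and \<open>Exists A\<close> bind index 0 of \<open>A\<close>, and an index that
  is not captured by a quantifier is a free variable. The language is parametrised by the
  function symbols \<open>'f\<close> and the predicate symbols \<open>'p\<close>; symbols may be used with every
  arity, and constants are function symbols applied to the empty list.
\<close>

datatype 'f tm = Var nat | Fun 'f "'f tm list"

datatype ('f, 'p) form =
    Atom 'p "'f tm list"
  | Conj "('f, 'p) form" "('f, 'p) form"
  | Disj "('f, 'p) form" "('f, 'p) form"
  | Imp "('f, 'p) form" "('f, 'p) form"
  | Forall "('f, 'p) form"
  | Exists "('f, 'p) form"

primrec fv_tm :: "'f tm \<Rightarrow> nat set" where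
  "fv_tm (Var i) = {i}"
| "fv_tm (Fun f ts) = \<Union> (set (map fv_tm ts))"

primrec fv :: "('f, 'p) form \<Rightarrow> nat set" where
  "fv (Atom P ts) = \<Union> (set (map fv_tm ts))"
| "fv (Conj A B) = fv A \<union> fv B"
| "fv (Disj A B) = fv A \<union> fv B"
| "fv (Imp A B) = fv A \<union> fv B"
| "fv (Forall A) = {i. Suc i \<in> fv A}"
| "fv (Exists A) = {i. Suc i \<in> fv A}"

definition closed_form :: "('f, 'p) form \<Rightarrow> bool" where
  "closed_form A \<longleftrightarrow> fv A = {}"

primrec subst_tm :: "(nat \<Rightarrow> 'f tm) \<Rightarrow> 'f tm \<Rightarrow> 'f tm" where
  "subst_tm \<sigma> (Var i) = \<sigma> i"
| "subst_tm \<sigma> (Fun f ts) = Fun f (map (subst_tm \<sigma>) ts)"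

definition up :: "(nat \<Rightarrow> 'f tm) \<Rightarrow> nat \<Rightarrow> 'f tm" where
  "up \<sigma> = case_nat (Var 0) (\<lambda>i. subst_tm (\<lambda>j. Var (Suc j)) (\<sigma> i))"

primrec subst :: "(nat \<Rightarrow> 'f tm) \<Rightarrow> ('f, 'p) form \<Rightarrow> ('f, 'p) form" where
  "subst \<sigma> (Atom P ts) = Atom P (map (subst_tm \<sigma>) ts)"
| "subst \<sigma> (Conj A B) = Conj (subst \<sigma> A) (subst \<sigma> B)"
| "subst \<sigma> (Disj A B) = Disj (subst \<sigma> A) (subst \<sigma> B)"
| "subst \<sigma> (Imp A B) = Imp (subst \<sigma> A) (subst \<sigma> B)"
| "subst \<sigma> (Forall A) = Forall (subst (up \<sigma>) A)"
| "subst \<sigma> (Exists A) = Exists (subst (up \<sigma>) A)"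

text \<open>
  If \<open>A\<close> is the body of a quantified formula, \<open>inst A t\<close> is the instance \<open>A(t)\<close>: index 0
  is replaced by \<open>t\<close> and all other indices are lowered by one.
\<close>

definition inst :: "('f, 'p) form \<Rightarrow> 'f tm \<Rightarrow> ('f, 'p) form" where
  "inst A t = subst (case_nat t Var) A"

text \<open>\<open>shift A\<close> is \<open>A\<close> under one more individual binder, whose variable is fresh for \<open>A\<close>.\<close>

definition shift :: "('f, 'p) form \<Rightarrow> ('f, 'p) form" where
  "shift A = subst (\<lambda>i. Var (Suc i)) A"

primrec connectives :: "('f, 'p) form \<Rightarrow> nat" where
  "connectives (Atom P ts) = 0"
| "connectives (Conj A B) = Suc (connectives A + connectives B)"
| "connectives (Disj A B) = Suc (connectives A + connectives B)"
| "connectives (Imp A B) = Suc (connectives A + connectives B)"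
| "connectives (Forall A) = Suc (connectives A)"
| "connectives (Exists A) = Suc (connectives A)"

lemma connectives_subst [simp]: "connectives (subst \<sigma> A) = connectives A"
  by (induction A arbitrary: \<sigma>) auto

lemma connectives_inst [simp]: "connectives (inst A t) = connectives A"
  by (simp add: inst_def)


section \<open>Natural deduction with proof terms\<close>

text \<open>
  Proof variables are named. A context assigns formulas to finitely many proof variables;
  \<open>\<Gamma>, a : A\<close> is \<open>fmupd a A \<Gamma>\<close>, so an inner binder hides an outer one of the same name.
\<close>

type_synonym ('f, 'p) ctx = "(nat, ('f, 'p) form) fmap"

definition closed_ctx :: "('f, 'p) ctx \<Rightarrow> bool" where
  "closed_ctx \<Gamma> \<longleftrightarrow> fmpred (\<lambda>a A. closed_form A) \<Gamma>"

text \<open>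
  \<open>Case p a q b r\<close> is \<open>case p of (a.q \<parallel> b.r)\<close>, \<open>LamI p\<close> is the abstraction over an
  individual variable, and \<open>Dest p a q\<close> is \<open>dest p as (x,a) in q\<close>. The individual
  variable bound in \<open>LamI p\<close> and in the body of \<open>Dest p a q\<close> is index 0.
\<close>

datatype 'f pterm =
    Hyp nat
  | Tup "'f pterm" "'f pterm"
  | Proj1 "'f pterm"
  | Proj2 "'f pterm"
  | Inj1 "'f pterm"
  | Inj2 "'f pterm"
  | Case "'f pterm" nat "'f pterm" nat "'f pterm"
  | Lam nat "'f pterm"
  | App "'f pterm" "'f pterm"
  | LamI "'f pterm"
  | AppI "'f pterm" "'f tm"
  | Wit "'f tm" "'f pterm"
  | Dest "'f pterm" nat "'f pterm"

text \<open>
  The freshness condition on the eigenvariable in the rules \<open>LamI\<close> and \<open>Dest\<close> is expressed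
  by shifting the context and, for \<open>Dest\<close>, the conclusion.
\<close>

inductive deriv :: "('f, 'p) ctx \<Rightarrow> 'f pterm \<Rightarrow> ('f, 'p) form \<Rightarrow> bool"
    (\<open>_ \<turnstile> _ \<Ztypecolon> _\<close> [50, 50, 50] 50) where
  Hyp: "fmlookup \<Gamma> a = Some A \<Longrightarrow> \<Gamma> \<turnstile> Hyp a \<Ztypecolon> A"
| Tup: "\<Gamma> \<turnstile> p \<Ztypecolon> A \<Longrightarrow> \<Gamma> \<turnstile> q \<Ztypecolon> B \<Longrightarrow> \<Gamma> \<turnstile> Tup p q \<Ztypecolon> Conj A B"
| Proj1: "\<Gamma> \<turnstile> p \<Ztypecolon> Conj A B \<Longrightarrow> \<Gamma> \<turnstile> Proj1 p \<Ztypecolon> A"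
| Proj2: "\<Gamma> \<turnstile> p \<Ztypecolon> Conj A B \<Longrightarrow> \<Gamma> \<turnstile> Proj2 p \<Ztypecolon> B"
| Inj1: "\<Gamma> \<turnstile> p \<Ztypecolon> A \<Longrightarrow> \<Gamma> \<turnstile> Inj1 p \<Ztypecolon> Disj A B"
| Inj2: "\<Gamma> \<turnstile> p \<Ztypecolon> B \<Longrightarrow> \<Gamma> \<turnstile> Inj2 p \<Ztypecolon> Disj A B"
| Case: "\<Gamma> \<turnstile> p \<Ztypecolon> Disj A B \<Longrightarrow> fmupd a A \<Gamma> \<turnstile> q \<Ztypecolon> C \<Longrightarrow> fmupd b B \<Gamma> \<turnstile> r \<Ztypecolon> C \<Longrightarrow>
    \<Gamma> \<turnstile> Case p a q b r \<Ztypecolon> C"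
| Lam: "fmupd a A \<Gamma> \<turnstile> p \<Ztypecolon> B \<Longrightarrow> \<Gamma> \<turnstile> Lam a p \<Ztypecolon> Imp A B"
| App: "\<Gamma> \<turnstile> p \<Ztypecolon> Imp A B \<Longrightarrow> \<Gamma> \<turnstile> q \<Ztypecolon> A \<Longrightarrow> \<Gamma> \<turnstile> App p q \<Ztypecolon> B"
| LamI: "fmmap shift \<Gamma> \<turnstile> p \<Ztypecolon> A \<Longrightarrow> \<Gamma> \<turnstile> LamI p \<Ztypecolon> Forall A"
| AppI: "\<Gamma> \<turnstile> p \<Ztypecolon> Forall A \<Longrightarrow> \<Gamma> \<turnstile> AppI p t \<Ztypecolon> inst A t"
| Wit: "\<Gamma> \<turnstile> p \<Ztypecolon> inst A t \<Longrightarrow> \<Gamma> \<turnstile> Wit t p \<Ztypecolon> Exists A"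
| Dest: "\<Gamma> \<turnstile> p \<Ztypecolon> Exists A \<Longrightarrow> fmupd a A (fmmap shift \<Gamma>) \<turnstile> q \<Ztypecolon> shift C \<Longrightarrow>
    \<Gamma> \<turnstile> Dest p a q \<Ztypecolon> C"

inductive normal :: "'f pterm \<Rightarrow> bool" and neutral :: "'f pterm \<Rightarrow> bool" where
  "neutral e \<Longrightarrow> normal e"
| "normal r \<Longrightarrow> normal (Lam a r)"
| "normal r \<Longrightarrow> normal (Inj1 r)"
| "normal r \<Longrightarrow> normal (Inj2 r)"
| "normal r \<Longrightarrow> normal s \<Longrightarrow> normal (Tup r s)"
| "normal r \<Longrightarrow> normal (LamI r)"
| "normal r \<Longrightarrow> normal (Wit t r)"
| "neutral (Hyp a)"
| "neutral e \<Longrightarrow> normal r \<Longrightarrow> neutral (App e r)"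
| "neutral e \<Longrightarrow> normal r \<Longrightarrow> normal s \<Longrightarrow> neutral (Case e a r b s)"
| "neutral e \<Longrightarrow> neutral (Proj1 e)"
| "neutral e \<Longrightarrow> neutral (Proj2 e)"
| "neutral e \<Longrightarrow> neutral (AppI e t)"
| "neutral e \<Longrightarrow> normal r \<Longrightarrow> neutral (Dest e a r)"

definition normal_derivable :: "('f, 'p) ctx \<Rightarrow> ('f, 'p) form \<Rightarrow> bool" where
  "normal_derivable \<Gamma> A \<longleftrightarrow> (\<exists>p. normal p \<and> \<Gamma> \<turnstile> p \<Ztypecolon> A)"


section \<open>IK-CPS models\<close>

text \<open>
  Quantifiers are interpreted by substitution, so domain elements are individual terms;
  names for further individuals can be supplied by the type \<open>'f\<close>.
  \<open>explodes M w C\<close> is the exploding-node relation at \<open>w\<close> for the formula \<open>C\<close>.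
\<close>

record ('w, 'f, 'p) ik_cps =
  worlds :: "'w set"
  leq :: "'w \<Rightarrow> 'w \<Rightarrow> bool"
  explodes :: "'w \<Rightarrow> ('f, 'p) form \<Rightarrow> bool"
  sforces_atom :: "'w \<Rightarrow> 'p \<Rightarrow> 'f tm list \<Rightarrow> bool"
  domain :: "'w \<Rightarrow> 'f tm set"

definition ik_cps_model :: "('w, 'f, 'p) ik_cps \<Rightarrow> bool" where
  "ik_cps_model M \<longleftrightarrow>
    reflp_on (worlds M) (leq M) \<and> transp_on (worlds M) (leq M) \<and>
    (\<forall>w\<in>worlds M. \<forall>w'\<in>worlds M. leq M w w' \<longrightarrow>
      (\<forall>P ts. sforces_atom M w P ts \<longrightarrow> sforces_atom M w' P ts) \<and>
      domain M w \<subseteq> domain M w')"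

function (sequential)
  forces :: "('w, 'f, 'p) ik_cps \<Rightarrow> 'w \<Rightarrow> ('f, 'p) form \<Rightarrow> bool" and
  sforces :: "('w, 'f, 'p) ik_cps \<Rightarrow> 'w \<Rightarrow> ('f, 'p) form \<Rightarrow> bool" where
  "forces M w A \<longleftrightarrow>
    (\<forall>C. \<forall>w'\<in>worlds M. leq M w w' \<longrightarrow>
      (\<forall>w''\<in>worlds M. leq M w' w'' \<longrightarrow> sforces M w'' A \<longrightarrow> explodes M w'' C) \<longrightarrow>
      explodes M w' C)"
| "sforces M w (Atom P ts) \<longleftrightarrow> sforces_atom M w P ts"
| "sforces M w (Conj A B) \<longleftrightarrow> forces M w A \<and> forces M w B"
| "sforces M w (Disj A B) \<longleftrightarrow> forces M w A \<or> forces M w B"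
| "sforces M w (Imp A B) \<longleftrightarrow>
    (\<forall>w'\<in>worlds M. leq M w w' \<longrightarrow> forces M w' A \<longrightarrow> forces M w' B)"
| "sforces M w (Forall A) \<longleftrightarrow>
    (\<forall>w'\<in>worlds M. leq M w w' \<longrightarrow> (\<forall>t\<in>domain M w'. forces M w' (inst A t)))"
| "sforces M w (Exists A) \<longleftrightarrow> (\<exists>t\<in>domain M w. forces M w (inst A t))"
  by pat_completeness auto
termination
  by (relation "measure (case_sum (\<lambda>(M, w, A). Suc (2 * connectives A))
    (\<lambda>(M, w, A). 2 * connectives A))") auto

declare forces.simps [simp del]


section \<open>The universal model\<close>

text \<open>
  Worlds are all contexts, open ones included, and the constant domain consists of all
  individual terms, variables included.
\<close>

definition universal :: "(('f, 'p) ctx, 'f, 'p) ik_cps" where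
  "universal = \<lparr>
    worlds = UNIV,
    leq = (\<lambda>\<Gamma> \<Delta>. \<Gamma> \<subseteq>\<^sub>f \<Delta>),
    explodes = normal_derivable,
    sforces_atom = (\<lambda>\<Gamma> P ts. normal_derivable \<Gamma> (Atom P ts)),
    domain = (\<lambda>\<Gamma>. UNIV)\<rparr>"

lemma deriv_weaken: "\<Gamma> \<turnstile> p \<Ztypecolon> A \<Longrightarrow> \<Gamma> \<subseteq>\<^sub>f \<Delta> \<Longrightarrow> \<Delta> \<turnstile> p \<Ztypecolon> A"
proof (induction arbitrary: \<Delta> rule: deriv.induct)
  case (Case \<Gamma> p A B a q C b r)
  have "fmupd a A \<Gamma> \<subseteq>\<^sub>f fmupd a A \<Delta>" "fmupd b B \<Gamma> \<subseteq>\<^sub>f fmupd b B \<Delta>"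
    using Case.prems by (auto simp: fmsubset.rep_eq map_le_def)
  then show ?case using Case by (blast intro: deriv.Case)
next
  case (Lam a A \<Gamma> p B)
  have "fmupd a A \<Gamma> \<subseteq>\<^sub>f fmupd a A \<Delta>"
    using Lam.prems by (auto simp: fmsubset.rep_eq map_le_def)
  then show ?case using Lam by (blast intro: deriv.Lam)
next
  case (LamI \<Gamma> p A)
  have "fmmap shift \<Gamma> \<subseteq>\<^sub>f fmmap shift \<Delta>"
    using LamI.prems by (auto simp: fmsubset.rep_eq map_le_def dom_def)
  then show ?case using LamI by (blast intro: deriv.LamI)
next
  case (Dest \<Gamma> p A a q C)
  have "fmupd a A (fmmap shift \<Gamma>) \<subseteq>\<^sub>f fmupd a A (fmmap shift \<Delta>)"
    using Dest.prems by (auto simp: fmsubset.rep_eq map_le_def dom_def)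
  then show ?case using Dest by (blast intro: deriv.Dest)
qed (auto intro: deriv.intros simp: fmsubset.rep_eq map_le_def dom_def)

lemma ik_cps_model_universal: "ik_cps_model universal"
  by (auto simp: ik_cps_model_def universal_def normal_derivable_def
      reflp_on_def transp_on_def fmsubset.rep_eq
      intro: deriv_weaken[unfolded fmsubset.rep_eq] map_le_trans)

end

theory Submission
  imports Defs
begin

text \<open>
  Reification and reflection are proved simultaneously by induction on the number of connectives,
  for arbitrary formulas and contexts: the bodies of quantifiers lead to open ones. The
  continuation quantifier in forcing lets \<open>Case\<close> and \<open>Dest\<close> be applied to the neutral term being
  reflected with an arbitrary formula as conclusion. A premise whose eigenvariable
  is bound is obtained from a normal derivation about a fresh free variable, by a renaming of
  individual variables, which preserves normality.
\<close>

section \<open>Substitution in formulas\<close>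

lemma subst_tm_comp: "subst_tm \<sigma> (subst_tm \<tau> t) = subst_tm (\<lambda>i. subst_tm \<sigma> (\<tau> i)) t"
  by (induction t) auto

lemma subst_tm_cong: "(\<And>i. i \<in> fv_tm t \<Longrightarrow> \<sigma> i = \<tau> i) \<Longrightarrow> subst_tm \<sigma> t = subst_tm \<tau> t"
  by (induction t) auto

lemma subst_tm_Var: "subst_tm Var t = t"
  by (induction t) (auto intro: map_idI)

text \<open>Shifting a term and then applying \<open>up \<sigma>\<close> amounts to applying
  \<sigma> and then shifting. This carries the composition law \<open>subst_comp\<close> under
  quantifiers.\<close>

lemma up_comp: "up (\<lambda>i. subst_tm \<sigma> (\<tau> i)) = (\<lambda>i. subst_tm (up \<sigma>) (up \<tau> i))"
  by (rule ext) (auto simp: up_def subst_tm_comp split: nat.split)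

lemma up_Var: "up Var = Var"
  by (rule ext) (auto simp: up_def split: nat.split)

lemma subst_comp: "subst \<sigma> (subst \<tau> A) = subst (\<lambda>i. subst_tm \<sigma> (\<tau> i)) A"
  by (induction A arbitrary: \<sigma> \<tau>) (auto simp: subst_tm_comp up_comp)

text \<open>Under a quantifier the lifted substitutions agree at index 0, and at
  \<open>Suc i\<close> as soon as the original ones agree at \<open>i\<close>. Restricting the
  premise to free variables is what lets freshness assumptions enter later.\<close>

lemma subst_cong: "(\<And>i. i \<in> fv A \<Longrightarrow> \<sigma> i = \<tau> i) \<Longrightarrow> subst \<sigma> A = subst \<tau> A"
proof (induction A arbitrary: \<sigma> \<tau>)
  case (Atom P ts)
  then show ?case by (auto intro!: subst_tm_cong)
next
  case (Conj A B)
  then show ?case by (metis UnCI fv.simps(2) subst.simps(2))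
next
  case (Disj A B)
  then show ?case by (metis UnCI fv.simps(3) subst.simps(3))
next
  case (Imp A B)
  then show ?case by (metis UnCI fv.simps(4) subst.simps(4))
next
  case (Forall A)
  have "subst (up \<sigma>) A = subst (up \<tau>) A"
    by (rule Forall.IH) (auto simp: up_def Forall.prems split: nat.split)
  then show ?case by simp
next
  case (Exists A)
  have "subst (up \<sigma>) A = subst (up \<tau>) A"
    by (rule Exists.IH) (auto simp: up_def Exists.prems split: nat.split)
  then show ?case by simp
qed

lemma subst_Var: "subst Var A = A"
  by (induction A) (auto simp: up_Var subst_tm_Var intro: map_idI)

text \<open>Once compositions are merged, both sides send index 0 to
  \<open>subst_tm \<sigma> t\<close> and \<open>Suc i\<close> to \<open>\<sigma> i\<close>: the
  instantiation cancels the shift made by \<open>up\<close>.\<close>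

lemma subst_inst: "subst \<sigma> (inst A t) = inst (subst (up \<sigma>) A) (subst_tm \<sigma> t)"
  unfolding inst_def subst_comp
  by (rule subst_cong)
    (auto simp: up_def subst_tm_comp subst_tm_Var split: nat.split)

lemma subst_up_shift: "subst (up \<sigma>) (shift A) = shift (subst \<sigma> A)"
  unfolding shift_def subst_comp by (rule subst_cong) (simp add: up_def)

lemma finite_fv_tm: "finite (fv_tm t)"
  by (induction t) auto

lemma finite_fv: "finite (fv A)"
proof (induction A)
  case (Forall A)
  then show ?case using finite_vimageI[of "fv A" Suc] by (simp add: vimage_def)
next
  case (Exists A)
  then show ?case using finite_vimageI[of "fv A" Suc] by (simp add: vimage_def)
qed (auto simp: finite_fv_tm)


section \<open>Substitution in derivations\<close>

text \<open>Only individual variables are replaced. Individual terms contain no proof variables, so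
  hypothesis names stay as they are, nothing is captured and no redex can arise.\<close>

primrec subst_pterm :: "(nat \<Rightarrow> 'f tm) \<Rightarrow> 'f pterm \<Rightarrow> 'f pterm" where
  "subst_pterm \<sigma> (Hyp a) = Hyp a"
| "subst_pterm \<sigma> (Tup p q) = Tup (subst_pterm \<sigma> p) (subst_pterm \<sigma> q)"
| "subst_pterm \<sigma> (Proj1 p) = Proj1 (subst_pterm \<sigma> p)"
| "subst_pterm \<sigma> (Proj2 p) = Proj2 (subst_pterm \<sigma> p)"
| "subst_pterm \<sigma> (Inj1 p) = Inj1 (subst_pterm \<sigma> p)"
| "subst_pterm \<sigma> (Inj2 p) = Inj2 (subst_pterm \<sigma> p)"
| "subst_pterm \<sigma> (Case p a q b r) =
    Case (subst_pterm \<sigma> p) a (subst_pterm \<sigma> q) b (subst_pterm \<sigma> r)"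
| "subst_pterm \<sigma> (Lam a p) = Lam a (subst_pterm \<sigma> p)"
| "subst_pterm \<sigma> (App p q) = App (subst_pterm \<sigma> p) (subst_pterm \<sigma> q)"
| "subst_pterm \<sigma> (LamI p) = LamI (subst_pterm (up \<sigma>) p)"
| "subst_pterm \<sigma> (AppI p t) = AppI (subst_pterm \<sigma> p) (subst_tm \<sigma> t)"
| "subst_pterm \<sigma> (Wit t p) = Wit (subst_tm \<sigma> t) (subst_pterm \<sigma> p)"
| "subst_pterm \<sigma> (Dest p a q) = Dest (subst_pterm \<sigma> p) a (subst_pterm (up \<sigma>) q)"

lemma normal_neutral_subst_pterm:
  "normal p \<Longrightarrow> normal (subst_pterm \<sigma> p)"
  "neutral e \<Longrightarrow> neutral (subst_pterm \<sigma> e)"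
  by (induction p and e arbitrary: \<sigma> and \<sigma> rule: normal_neutral.inducts)
    (auto intro: normal_neutral.intros)

lemma fmmap_subst_up_shift:
  "fmmap (subst (up \<sigma>)) (fmmap shift \<Gamma>) = fmmap shift (fmmap (subst \<sigma>) \<Gamma>)"
  by (rule fmap_ext) (simp add: option.map_comp o_def subst_up_shift)

text \<open>At \<open>LamI\<close> and \<open>Dest\<close> the substitution is lifted by
  \<open>up\<close>. Lifting commutes with \<open>shift\<close>, which encodes the eigenvariable
  condition, so no fresh variable has to be chosen.\<close>

lemma deriv_subst: "\<Gamma> \<turnstile> p \<Ztypecolon> A \<Longrightarrow> fmmap (subst \<sigma>) \<Gamma> \<turnstile> subst_pterm \<sigma> p \<Ztypecolon> subst \<sigma> A"
proof (induction arbitrary: \<sigma> rule: deriv.induct)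
  case (Case \<Gamma> p A B a q C b r)
  then show ?case
    using deriv.Case[of "fmmap (subst \<sigma>) \<Gamma>" "subst_pterm \<sigma> p" "subst \<sigma> A" "subst \<sigma> B" a
        "subst_pterm \<sigma> q" "subst \<sigma> C" b "subst_pterm \<sigma> r"]
    by (simp add: fmmap_fmupd)
next
  case (Lam a A \<Gamma> p B)
  then show ?case
    using deriv.Lam[of a "subst \<sigma> A" "fmmap (subst \<sigma>) \<Gamma>"] by (simp add: fmmap_fmupd)
next
  case (LamI \<Gamma> p A)
  have "fmmap shift (fmmap (subst \<sigma>) \<Gamma>) \<turnstile> subst_pterm (up \<sigma>) p \<Ztypecolon> subst (up \<sigma>) A"
    using LamI.IH[of "up \<sigma>"] by (simp only: fmmap_subst_up_shift)
  then show ?case by (auto intro: deriv.LamI)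
next
  case (AppI \<Gamma> p A t)
  then show ?case by (auto simp: subst_inst intro: deriv.AppI)
next
  case (Wit \<Gamma> p A t)
  then show ?case by (auto simp: subst_inst intro: deriv.Wit)
next
  case (Dest \<Gamma> p A a q C)
  have "fmupd a (subst (up \<sigma>) A) (fmmap shift (fmmap (subst \<sigma>) \<Gamma>))
      \<turnstile> subst_pterm (up \<sigma>) q \<Ztypecolon> shift (subst \<sigma> C)"
    using Dest.IH(2)[of "up \<sigma>"] by (simp only: fmmap_fmupd fmmap_subst_up_shift subst_up_shift)
  then show ?case using Dest.IH(1)[of \<sigma>] by (auto intro: deriv.Dest)
qed (auto intro: deriv.intros)

lemma normal_derivable_subst:
  "normal_derivable \<Gamma> A \<Longrightarrow> normal_derivable (fmmap (subst \<sigma>) \<Gamma>) (subst \<sigma> A)"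
  unfolding normal_derivable_def using normal_neutral_subst_pterm(1) deriv_subst by blast

text \<open>Closing over \<open>x\<close>: the free variable \<open>x\<close> becomes the index of a
  new innermost binder, and all other variables make room for it.\<close>

definition bind :: "nat \<Rightarrow> nat \<Rightarrow> 'f tm" where
  "bind x i = (if i = x then Var 0 else Var (Suc i))"

lemma subst_bind_shift: "x \<notin> fv A \<Longrightarrow> subst (bind x) A = shift A"
  unfolding shift_def by (rule subst_cong) (auto simp: bind_def)

text \<open>Opening sends 0 to \<open>x\<close> and \<open>Suc i\<close> to \<open>i\<close>;
  \<open>bind x\<close> sends them back unless \<open>i = x\<close>, which the assumption
  excludes.\<close>

lemma subst_bind_inst:
  assumes "Suc x \<notin> fv A"
  shows "subst (bind x) (inst A (Var x)) = A"
proof -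
  have "subst (bind x) (inst A (Var x)) = subst Var A"
    unfolding inst_def subst_comp
    using assms by (intro subst_cong) (auto simp: bind_def split: nat.split)
  then show ?thesis by (simp add: subst_Var)
qed

lemma fmmap_subst_bind:
  assumes "x \<notin> (\<Union>B\<in>fmran' \<Gamma>. fv B)"
  shows "fmmap (subst (bind x)) \<Gamma> = fmmap shift \<Gamma>"
proof (rule fmap_ext)
  fix a
  show "fmlookup (fmmap (subst (bind x)) \<Gamma>) a = fmlookup (fmmap shift \<Gamma>) a"
    using assms subst_bind_shift by (cases "fmlookup \<Gamma> a") (auto dest: fmran'I)
qed

text \<open>Contexts are finite, so only finitely many variables are excluded. \<open>A\<close> is
  meant as the body of a quantifier, inside which the outer variable \<open>x\<close> has index
  \<open>Suc x\<close>.\<close>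

lemma obtain_fresh_var:
  obtains x where "x \<notin> (\<Union>B\<in>fmran' \<Gamma>. fv B)" "Suc x \<notin> fv A" "x \<notin> fv C"
proof -
  have "finite ((\<Union>B\<in>fmran' \<Gamma>. fv B) \<union> Suc -` fv A \<union> fv C)"
    by (auto simp: finite_fv fmran'_alt_def intro: finite_vimageI)
  from ex_new_if_finite[OF infinite_UNIV_nat this] show ?thesis using that by auto
qed


section \<open>Normal derivability\<close>

text \<open>With a used name the update could overwrite a hypothesis and fail to give a larger
  world. The name is independent of \<open>A\<close>, so one name serves both branches of a
  \<open>Case\<close>.\<close>

lemma obtain_fresh_hyp:
  fixes \<Gamma> :: "('f, 'p) ctx"
  obtains a where "\<And>A. \<Gamma> \<subseteq>\<^sub>f fmupd a A \<Gamma>"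
proof -
  obtain a where "a \<notin> fmdom' \<Gamma>"
    using ex_new_if_finite[OF infinite_UNIV_nat, of "fmdom' \<Gamma>"] by auto
  then have "\<Gamma> \<subseteq>\<^sub>f fmupd a A \<Gamma>" for A
    by (auto simp: fmsubset.rep_eq map_le_def fmlookup_dom'_iff dom_def)
  then show ?thesis by (rule that)
qed

lemma deriv_Hyp_fmupd: "fmupd a A \<Gamma> \<turnstile> Hyp a \<Ztypecolon> A"
  by (simp add: deriv.Hyp)

lemma normal_derivable_neutral: "neutral e \<Longrightarrow> \<Gamma> \<turnstile> e \<Ztypecolon> A \<Longrightarrow> normal_derivable \<Gamma> A"
  unfolding normal_derivable_def by (blast intro: normal_neutral.intros(1))

lemma normal_derivable_intros:
  "normal_derivable \<Gamma> A \<Longrightarrow> normal_derivable \<Gamma> B \<Longrightarrow> normal_derivable \<Gamma> (Conj A B)"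
  "normal_derivable \<Gamma> A \<Longrightarrow> normal_derivable \<Gamma> (Disj A B)"
  "normal_derivable \<Gamma> B \<Longrightarrow> normal_derivable \<Gamma> (Disj A B)"
  "normal_derivable (fmupd a A \<Gamma>) B \<Longrightarrow> normal_derivable \<Gamma> (Imp A B)"
  "normal_derivable (fmmap shift \<Gamma>) D \<Longrightarrow> normal_derivable \<Gamma> (Forall D)"
  "normal_derivable \<Gamma> (inst D t) \<Longrightarrow> normal_derivable \<Gamma> (Exists D)"
  unfolding normal_derivable_def by (blast intro: deriv.intros normal_neutral.intros)+

lemma normal_derivable_Case:
  assumes "neutral e" "\<Gamma> \<turnstile> e \<Ztypecolon> Disj A B"
    and "normal_derivable (fmupd a A \<Gamma>) C" "normal_derivable (fmupd b B \<Gamma>) C"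
  shows "normal_derivable \<Gamma> C"
  using assms unfolding normal_derivable_def
  by (blast intro: deriv.Case normal_neutral.intros)

lemma normal_derivable_Dest:
  assumes "neutral e" "\<Gamma> \<turnstile> e \<Ztypecolon> Exists A"
    and "normal_derivable (fmupd a A (fmmap shift \<Gamma>)) (shift C)"
  shows "normal_derivable \<Gamma> C"
  using assms unfolding normal_derivable_def
  by (blast intro: deriv.Dest normal_neutral.intros)

text \<open>Closing over \<open>x\<close> turns the derivation of the instance into the premise of
  \<open>LamI\<close>, in the shifted context.\<close>

lemma normal_derivable_Forall_fresh:
  assumes "x \<notin> (\<Union>B\<in>fmran' \<Gamma>. fv B)" "Suc x \<notin> fv A"
    and "normal_derivable \<Gamma> (inst A (Var x))"
  shows "normal_derivable \<Gamma> (Forall A)"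
  using normal_derivable_subst[OF assms(3), of "bind x"]
  unfolding fmmap_subst_bind[OF assms(1)] subst_bind_inst[OF assms(2)]
  by (rule normal_derivable_intros(5))

text \<open>Closing over \<open>x\<close> produces the second premise of \<open>Dest\<close>;
  freshness for \<open>C\<close> makes the renamed conclusion equal to
  \<open>shift C\<close>.\<close>

lemma normal_derivable_Dest_fresh:
  assumes "neutral e" "\<Gamma> \<turnstile> e \<Ztypecolon> Exists A"
    and "x \<notin> (\<Union>B\<in>fmran' \<Gamma>. fv B)" "Suc x \<notin> fv A" "x \<notin> fv C"
    and "normal_derivable (fmupd a (inst A (Var x)) \<Gamma>) C"
  shows "normal_derivable \<Gamma> C"
proof (rule normal_derivable_Dest[OF assms(1,2)])
  show "normal_derivable (fmupd a A (fmmap shift \<Gamma>)) (shift C)"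
    using normal_derivable_subst[OF assms(6), of "bind x"]
    unfolding fmmap_fmupd fmmap_subst_bind[OF assms(3)] subst_bind_inst[OF assms(4)]
      subst_bind_shift[OF assms(5)] .
qed


section \<open>Forcing in the universal model\<close>

lemma fmsubset_refl: "\<Gamma> \<subseteq>\<^sub>f \<Gamma>"
  by (simp add: fmsubset.rep_eq)

lemma forces_universal_iff:
  "forces universal \<Gamma> A \<longleftrightarrow>
    (\<forall>C \<Delta>. \<Gamma> \<subseteq>\<^sub>f \<Delta> \<longrightarrow>
      (\<forall>\<Theta>. \<Delta> \<subseteq>\<^sub>f \<Theta> \<longrightarrow> sforces universal \<Theta> A \<longrightarrow> normal_derivable \<Theta> C) \<longrightarrow>
      normal_derivable \<Delta> C)"
  by (subst forces.simps) (simp add: universal_def)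

lemma sforces_universal_iff:
  "sforces universal \<Gamma> (Atom P ts) \<longleftrightarrow> normal_derivable \<Gamma> (Atom P ts)"
  "sforces universal \<Gamma> (Imp A B) \<longleftrightarrow>
    (\<forall>\<Delta>. \<Gamma> \<subseteq>\<^sub>f \<Delta> \<longrightarrow> forces universal \<Delta> A \<longrightarrow> forces universal \<Delta> B)"
  "sforces universal \<Gamma> (Forall D) \<longleftrightarrow>
    (\<forall>\<Delta>. \<Gamma> \<subseteq>\<^sub>f \<Delta> \<longrightarrow> (\<forall>t. forces universal \<Delta> (inst D t)))"
  "sforces universal \<Gamma> (Exists D) \<longleftrightarrow> (\<exists>t. forces universal \<Gamma> (inst D t))"
  by (auto simp: universal_def)

text \<open>The two halves need each other: for an implication, each uses the other half at the
  antecedent. The number of connectives serves as measure because \<open>inst D t\<close> is not a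
  subformula of the quantified formula but has one connective less.\<close>

lemma reify_reflect:
  fixes A :: "('f, 'p) form" and \<Gamma> :: "('f, 'p) ctx"
  shows "(forces universal \<Gamma> A \<longrightarrow> normal_derivable \<Gamma> A) \<and>
    (\<forall>e. neutral e \<and> \<Gamma> \<turnstile> e \<Ztypecolon> A \<longrightarrow> forces universal \<Gamma> A)"
proof (induction "connectives A" arbitrary: A \<Gamma> rule: less_induct)
  case less
  have reify: "normal_derivable \<Delta> B"
    if "connectives B < connectives A" "forces universal \<Delta> B" for \<Delta> and B :: "('f, 'p) form"
    using less[OF that(1)] that(2) by blast
  have reflect: "forces universal \<Delta> B"
    if "connectives B < connectives A" "neutral e" "\<Delta> \<turnstile> e \<Ztypecolon> B" for \<Delta> e and B :: "('f, 'p) form"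
    using less[OF that(1)] that(2,3) by blast
  have reflect_Hyp: "forces universal (fmupd a B \<Delta>) B"
    if "connectives B < connectives A" for \<Delta> a and B :: "('f, 'p) form"
    \<comment> \<open>The rule cited by number says that hypotheses are neutral.\<close>
    using that normal_neutral.intros(8) deriv_Hyp_fmupd by (rule reflect)
  have reify_strong: "normal_derivable \<Delta> A" if s: "sforces universal \<Delta> A" for \<Delta>
  proof (cases A)
    case (Atom P ts)
    then show ?thesis using s by (simp only: sforces_universal_iff)
  next
    case (Conj B C)
    then show ?thesis using s reify[of B] reify[of C] by (auto intro: normal_derivable_intros)
  next
    case (Disj B C)
    then show ?thesis using s reify[of B] reify[of C] by (auto intro: normal_derivable_intros)
  next
    case (Imp B C)
    obtain a where "\<And>B. \<Delta> \<subseteq>\<^sub>f fmupd a B \<Delta>" using obtain_fresh_hyp by blast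
    then have "forces universal (fmupd a B \<Delta>) C"
      using s reflect_Hyp[of B] unfolding Imp sforces_universal_iff by simp
    then show ?thesis using reify[of C] unfolding Imp by (auto intro: normal_derivable_intros(4))
  next
    case (Forall D)
    obtain x where x: "x \<notin> (\<Union>B\<in>fmran' \<Delta>. fv B)" "Suc x \<notin> fv D"
      by (rule obtain_fresh_var)
    \<comment> \<open>The domain contains variables, so the fresh \<open>x\<close> itself may be
      taken as the individual.\<close>
    have "forces universal \<Delta> (inst D (Var x))"
      using s fmsubset_refl unfolding Forall sforces_universal_iff by blast
    then show ?thesis
      using reify[of "inst D (Var x)"] normal_derivable_Forall_fresh[OF x] unfolding Forall by simp
  next
    case (Exists D)
    then obtain t where "forces universal \<Delta> (inst D t)"
      using s by (auto simp only: sforces_universal_iff)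
    then show ?thesis
      using reify[of "inst D t"] normal_derivable_intros(6) unfolding Exists by auto
  qed
  have "normal_derivable \<Gamma> A" if "forces universal \<Gamma> A"
    \<comment> \<open>Forcing is used with \<open>A\<close> itself as the conclusion
      \<open>C\<close> and at the world \<Gamma>; \<open>reify_strong\<close> is the
      continuation.\<close>
    using that reify_strong fmsubset_refl unfolding forces_universal_iff by blast
  moreover have "forces universal \<Gamma> A" if e: "neutral e" and ge: "\<Gamma> \<turnstile> e \<Ztypecolon> A" for e
    unfolding forces_universal_iff
  proof (intro allI impI)
    fix C \<Delta>
    assume "\<Gamma> \<subseteq>\<^sub>f \<Delta>"
      and "\<forall>\<Theta>. \<Delta> \<subseteq>\<^sub>f \<Theta> \<longrightarrow> sforces universal \<Theta> A \<longrightarrow> normal_derivable \<Theta> C"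
    then have k: "\<And>\<Theta>. \<Delta> \<subseteq>\<^sub>f \<Theta> \<Longrightarrow> sforces universal \<Theta> A \<Longrightarrow> normal_derivable \<Theta> C" by blast
    have de: "\<Delta> \<turnstile> e \<Ztypecolon> A" using ge \<open>\<Gamma> \<subseteq>\<^sub>f \<Delta>\<close> by (rule deriv_weaken)
    obtain a where a: "\<And>B. \<Delta> \<subseteq>\<^sub>f fmupd a B \<Delta>" using obtain_fresh_hyp by blast
    show "normal_derivable \<Delta> C"
    \<comment> \<open>Except for \<open>Disj\<close> and \<open>Exists\<close>, \<open>A\<close> is
      strongly forced at \<Delta> itself, and \<open>k\<close> is applied there.\<close>
    proof (cases A)
      case (Atom P ts)
      have "sforces universal \<Delta> A"
        using e de unfolding Atom sforces_universal_iff by (rule normal_derivable_neutral)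
      then show ?thesis by (rule k[OF fmsubset_refl])
    next
      case (Conj B B')
      have "forces universal \<Delta> B" "forces universal \<Delta> B'"
        using reflect[of B "Proj1 e" \<Delta>] reflect[of B' "Proj2 e" \<Delta>] e de unfolding Conj
        by (auto intro: normal_neutral.intros deriv.intros)
      then show ?thesis using k[OF fmsubset_refl] Conj by simp
    next
      case (Disj B B')
      \<comment> \<open>The term \<open>e\<close> need not decide a disjunct, so \<open>k\<close> is
        applied in two larger worlds, each assuming one disjunct, and \<open>Case\<close> on
        \<open>e\<close> joins the results.\<close>
      have "normal_derivable (fmupd a B \<Delta>) C" "normal_derivable (fmupd a B' \<Delta>) C"
        using k[OF a] reflect_Hyp[of B] reflect_Hyp[of B'] unfolding Disj by simp_all
      then show ?thesis by (rule normal_derivable_Case[OF e de[unfolded Disj]])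
    next
      case (Imp B B')
      have "forces universal \<Theta> B'" if le: "\<Delta> \<subseteq>\<^sub>f \<Theta>" and B: "forces universal \<Theta> B" for \<Theta>
      proof -
        \<comment> \<open>Reifying the argument gives a normal \<open>q\<close>, so that
          \<open>App e q\<close> is again neutral and can be reflected.\<close>
        obtain q where "normal q" "\<Theta> \<turnstile> q \<Ztypecolon> B"
          using reify[of B] B unfolding Imp normal_derivable_def by auto
        then have "\<Theta> \<turnstile> App e q \<Ztypecolon> B'" "neutral (App e q)"
          using e deriv_weaken[OF de le] unfolding Imp
          by (auto intro: normal_neutral.intros deriv.App)
        then show ?thesis using reflect[of B'] Imp by simp
      qed
      then have "sforces universal \<Delta> A" unfolding Imp sforces_universal_iff by blast
      then show ?thesis by (rule k[OF fmsubset_refl])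
    next
      case (Forall D)
      have "forces universal \<Theta> (inst D t)" if "\<Delta> \<subseteq>\<^sub>f \<Theta>" for \<Theta> t
        using reflect[of "inst D t" "AppI e t"] e deriv_weaken[OF de that] unfolding Forall
        by (auto intro: normal_neutral.intros deriv.AppI)
      then have "sforces universal \<Delta> A" unfolding Forall sforces_universal_iff by blast
      then show ?thesis by (rule k[OF fmsubset_refl])
    next
      case (Exists D)
      \<comment> \<open>The witness is unknown, so a fresh variable stands for it while
        \<open>k\<close> is applied; \<open>Dest\<close> on \<open>e\<close> then discharges the
        added hypothesis.\<close>
      obtain x where x: "x \<notin> (\<Union>B\<in>fmran' \<Delta>. fv B)" "Suc x \<notin> fv D" "x \<notin> fv C"
        by (rule obtain_fresh_var)
      have "forces universal (fmupd a (inst D (Var x)) \<Delta>) (inst D (Var x))"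
        using reflect_Hyp[of "inst D (Var x)"] Exists by simp
      then have "sforces universal (fmupd a (inst D (Var x)) \<Delta>) A"
        unfolding Exists sforces_universal_iff by blast
      then have "normal_derivable (fmupd a (inst D (Var x)) \<Delta>) C" by (rule k[OF a])
      then show ?thesis by (rule normal_derivable_Dest_fresh[OF e de[unfolded Exists] x])
    qed
  qed
  ultimately show ?case by blast
qed

theorem theorem14:
  fixes A :: "('f, 'p) form" and \<Gamma> :: "('f, 'p) ctx"
  assumes "closed_form A" and "closed_ctx \<Gamma>"
  shows "(forces universal \<Gamma> A \<longrightarrow> (\<exists>p. normal p \<and> \<Gamma> \<turnstile> p \<Ztypecolon> A)) \<and>
         (\<forall>e. neutral e \<and> \<Gamma> \<turnstile> e \<Ztypecolon> A \<longrightarrow> forces universal \<Gamma> A)"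
  using reify_reflect[of \<Gamma> A] unfolding normal_derivable_def .

end
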